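(* For every integer $n\geq 2$, $\gamma_2(G_{2,n})=n$ and $b_2(G_{2,n})=1$.
   Context: For a graph $G$, a set $D\subseteq V(G)$ is a $2$-dominating set if every vertex not in $D$ has at least $2$ neighbours in $D$. The $2$-domination number $\gamma_2(G)$ is the minimum cardinality of a $2$-dominating set of $G$. The $2$-bondage number $b_2(G)$ is the minimum cardinality of an edge set $B\subseteq E(G)$ such that $\gamma_2(G-B)>\gamma_2(G)$, where $G-B$ has vertex set $V(G)$ and edge set $E(G)\setminus B$. The grid graph $G_{m,n}=P_m\times P_n$ has vertex set $[m]\times[n]$ (where $[k]=\{1,\dots,k\}$), with $(i,j)$ and $(i',j')$ adjacent iff $|i-i'|+|j-j'|=1$. *)

theory Defs
  imports "HOL-Library.Extended_Nat"
begin

text \<open>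
  Undirected simple graphs, with edges represented as two-element sets of vertices.
  All notions below are intended for finite graphs.
\<close>

record 'a sgraph =
  verts :: "'a set"
  edges :: "'a set set"

definition finite_simple_graph :: "'a sgraph \<Rightarrow> bool" where
  "finite_simple_graph G \<longleftrightarrow>
     finite (verts G) \<and> (\<forall>e\<in>edges G. e \<subseteq> verts G \<and> card e = 2)"

definition neighbours :: "'a sgraph \<Rightarrow> 'a \<Rightarrow> 'a set" where
  "neighbours G v = {u \<in> verts G. {u, v} \<in> edges G}"

definition delete_edges :: "'a sgraph \<Rightarrow> 'a set set \<Rightarrow> 'a sgraph" where
  "delete_edges G B = \<lparr>verts = verts G, edges = edges G - B\<rparr>"

definition two_dominating_set :: "'a sgraph \<Rightarrow> 'a set \<Rightarrow> bool" where
  "two_dominating_set G D \<longleftrightarrow>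
     D \<subseteq> verts G \<and> (\<forall>v \<in> verts G - D. card (neighbours G v \<inter> D) \<ge> 2)"

text \<open>
  Minima are taken in the extended naturals, where a nonempty set attains its infimum
  and the infimum of the empty set is \<open>\<infinity>\<close>. For a finite graph the 2-domination number
  is always finite, since the full vertex set is 2-dominating, whereas the 2-bondage
  number is \<open>\<infinity>\<close> if no edge deletion increases the 2-domination number.
\<close>

definition two_domination_number :: "'a sgraph \<Rightarrow> enat" where
  "two_domination_number G = Inf {enat (card D) | D. two_dominating_set G D}"

definition two_bondage_number :: "'a sgraph \<Rightarrow> enat" where
  "two_bondage_number G =
     Inf {enat (card B) | B. B \<subseteq> edges G \<and>
            two_domination_number (delete_edges G B) > two_domination_number G}"

definition grid_graph :: "nat \<Rightarrow> nat \<Rightarrow> (nat \<times> nat) sgraph" where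
  "grid_graph m n =
     \<lparr>verts = {1..m} \<times> {1..n},
      edges = {{(i, j), (i', j')} | i j i' j'.
                 (i, j) \<in> {1..m} \<times> {1..n} \<and> (i', j') \<in> {1..m} \<times> {1..n} \<and>
                 \<bar>int i - int i'\<bar> + \<bar>int j - int j'\<bar> = 1}\<rparr>"

lemma finite_simple_graph_grid_graph: "finite_simple_graph (grid_graph m n)"
  by (auto simp: finite_simple_graph_def grid_graph_def card_2_iff) force+

end

theory Submission
  imports Defs
begin

text \<open>
  If a 2-dominating set \<open>D\<close> of the ladder misses a column, it contains both neighbouring
  columns. Sending a nonempty column to one of its own members and an empty column to the
  second member of the next column is therefore an injection of the columns into \<open>D\<close>, so
  \<open>card D \<ge> n\<close>; alternating the rows attains equality. Deleting the rung of the first column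
  leaves its two vertices with degree one, which forces both of them into \<open>D\<close>. The
  injection then misses one of them, so \<open>card D \<ge> n + 1\<close>.
\<close>

text \<open>An edge is an unordered pair, so its representation in \<open>grid_graph\<close> may
  list the endpoints in either order; the adjacency condition is symmetric, so this makes no
  difference.\<close>

lemma edge_grid_graph_iff:
  "{(i, j), (i', j')} \<in> edges (grid_graph m n) \<longleftrightarrow>
     (i, j) \<in> {1..m} \<times> {1..n} \<and> (i', j') \<in> {1..m} \<times> {1..n} \<and>
     \<bar>int i - int i'\<bar> + \<bar>int j - int j'\<bar> = 1" (is "?edge \<longleftrightarrow> ?adj")
proof
  assume ?edge
  then obtain a b a' b' where "{(i, j), (i', j')} = {(a, b), (a', b')}"
    and "(a, b) \<in> {1..m} \<times> {1..n}" "(a', b') \<in> {1..m} \<times> {1..n}"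
    and "\<bar>int a - int a'\<bar> + \<bar>int b - int b'\<bar> = 1"
    unfolding grid_graph_def sgraph.select_convs mem_Collect_eq by (elim exE conjE) (rule that)
  then show ?adj
    by (auto simp: doubleton_eq_iff abs_minus_commute)
next
  assume ?adj
  then show ?edge
    unfolding grid_graph_def sgraph.select_convs mem_Collect_eq
    by (intro exI conjI) (rule refl, blast+)
qed

lemma verts_grid_graph [simp]: "verts (grid_graph m n) = {1..m} \<times> {1..n}"
  by (simp add: grid_graph_def)

lemma verts_delete_edges [simp]: "verts (delete_edges G B) = verts G"
  by (simp add: delete_edges_def)

lemma delete_edges_empty [simp]: "delete_edges G {} = G"
  by (simp add: delete_edges_def)

text \<open>Here \<open>3 - r\<close> is the other row. At the two ends, columns \<open>0\<close>
  and \<open>n + 1\<close> lie outside the grid, so an inclusion covers all columns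
  uniformly.\<close>

lemma neighbours_ladder_subset:
  "neighbours (grid_graph 2 n) (r, j) \<subseteq> {(3 - r, j), (r, j + 1), (r, j - 1)}"
  by (auto simp: neighbours_def edge_grid_graph_iff)

text \<open>Deleting edges only shrinks neighbourhoods, so lower bounds proved for the ladder carry
  over to its subgraphs.\<close>

lemma two_dominating_set_delete_edgesD:
  assumes "finite (verts G)" "two_dominating_set (delete_edges G B) D"
  shows "two_dominating_set G D"
  unfolding two_dominating_set_def
proof (intro conjI ballI)
  show "D \<subseteq> verts G"
    using assms(2) by (simp add: two_dominating_set_def)
  fix v assume "v \<in> verts G - D"
  then have "2 \<le> card (neighbours (delete_edges G B) v \<inter> D)"
    using assms(2) by (simp add: two_dominating_set_def)
  also have "\<dots> \<le> card (neighbours G v \<inter> D)"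
    by (rule card_mono) (use assms(1) in \<open>auto simp: neighbours_def delete_edges_def\<close>)
  finally show "2 \<le> card (neighbours G v \<inter> D)" .
qed

lemma two_le_card_subset_doubletonD:
  assumes "2 \<le> card A" "A \<subseteq> {a, b}"
  shows "a \<in> A" "b \<in> A"
proof -
  have "card A \<le> card {a, b}"
    using assms(2) by (intro card_mono) auto
  moreover have "card {a, b} \<le> 2"
    by (simp add: card_insert_if)
  ultimately have "A = {a, b}"
    using assms by (intro card_subset_eq) auto
  then show "a \<in> A" "b \<in> A" by auto
qed

text \<open>The rung neighbour of \<open>(r, j)\<close> is not in \<open>D\<close>, so only the two
  horizontal candidates remain and both must be in \<open>D\<close>. For \<open>j = n\<close> this
  puts a vertex outside the grid into \<open>D\<close>, so the last column is never empty.\<close>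

lemma ladder_empty_column:
  assumes D: "two_dominating_set (grid_graph 2 n) D" and j: "j \<in> {1..n}"
    and empty: "(1, j) \<notin> D" "(2, j) \<notin> D" and r: "r \<in> {1, 2}"
  shows "(r, j + 1) \<in> D"
proof -
  let ?A = "neighbours (grid_graph 2 n) (r, j) \<inter> D"
  have "2 \<le> card ?A"
    using D j empty r by (auto simp: two_dominating_set_def)
  moreover have "?A \<subseteq> {(r, j + 1), (r, j - 1)}"
    using neighbours_ladder_subset[of n r j] empty r by auto
  ultimately have "(r, j + 1) \<in> ?A"
    by (rule two_le_card_subset_doubletonD(1))
  then show ?thesis by simp
qed

text \<open>Row 1 takes precedence, so a full column leaves its row 2 vertex free for an empty
  column on its left.\<close>

definition ladder_choice :: "(nat \<times> nat) set \<Rightarrow> nat \<Rightarrow> nat \<times> nat" where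
  "ladder_choice D j =
     (if (1, j) \<in> D then (1, j) else if (2, j) \<in> D then (2, j) else (2, j + 1))"

lemma ladder_choice_in:
  assumes "two_dominating_set (grid_graph 2 n) D" "j \<in> {1..n}"
  shows "ladder_choice D j \<in> D"
  using ladder_empty_column[OF assms, of 2] by (simp add: ladder_choice_def)

text \<open>A collision could only occur between an empty column \<open>j\<close> and column
  \<open>j + 1\<close>; but then \<open>(1, j + 1)\<close> is in \<open>D\<close>, so column
  \<open>j + 1\<close> chooses row 1 and not \<open>(2, j + 1)\<close>.\<close>

lemma inj_on_ladder_choice:
  assumes "two_dominating_set (grid_graph 2 n) D"
  shows "inj_on (ladder_choice D) {1..n}"
proof (rule inj_onI)
  fix j k
  assume j: "j \<in> {1..n}" and k: "k \<in> {1..n}" and eq: "ladder_choice D j = ladder_choice D k"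
  show "j = k"
    using eq ladder_empty_column[OF assms j, of 1] ladder_empty_column[OF assms k, of 1]
    by (auto simp: ladder_choice_def split: if_splits)
qed

lemma finite_two_dominating_set_grid_graph:
  "two_dominating_set (grid_graph m n) D \<Longrightarrow> finite D"
  unfolding two_dominating_set_def verts_grid_graph
  by (meson finite_SigmaI finite_atLeastAtMost finite_subset)

lemma card_ladder_two_dominating_set:
  assumes "two_dominating_set (grid_graph 2 n) D"
  shows "n \<le> card D"
proof -
  have "ladder_choice D ` {1..n} \<subseteq> D"
    using ladder_choice_in[OF assms] by blast
  then show ?thesis
    using card_inj_on_le[OF inj_on_ladder_choice[OF assms] _ finite_two_dominating_set_grid_graph[OF assms]]
    by (simp del: atLeastAtMost_iff One_nat_def)
qed

lemma card_ladder_two_dominating_set_full_column: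
  assumes "two_dominating_set (grid_graph 2 n) D" "(1, 1) \<in> D" "(2, 1) \<in> D"
  shows "Suc n \<le> card D"
proof -
  have fin: "finite D"
    using assms(1) by (rule finite_two_dominating_set_grid_graph)
  \<comment> \<open>Column 1 chooses \<open>(1, 1)\<close>, and there is no column 0 that could be
    sent to \<open>(2, 1)\<close>.\<close>
  have "ladder_choice D j \<noteq> (2, 1)" if "j \<in> {1..n}" for j
    using that assms(2) by (auto simp: ladder_choice_def)
  then have "ladder_choice D ` {1..n} \<subseteq> D - {(2, 1)}"
    by (intro image_subsetI DiffI ladder_choice_in[OF assms(1)]) simp_all
  then have "n \<le> card (D - {(2, 1)})"
    using card_inj_on_le[OF inj_on_ladder_choice[OF assms(1)], of "D - {(2, 1)}"] fin
    by (simp del: atLeastAtMost_iff One_nat_def)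
  \<comment> \<open>Positivity keeps the truncated subtraction in \<open>card D - 1\<close>
    exact.\<close>
  moreover have "0 < card D"
    using assms(2) fin by (auto simp: card_gt_0_iff)
  ultimately show ?thesis
    using assms(3) by (simp add: card_Diff_singleton)
qed

definition alternating :: "nat \<Rightarrow> (nat \<times> nat) set" where
  "alternating n = (\<lambda>j. (1 + j mod 2, j)) ` {1..n}"

lemma card_alternating: "card (alternating n) = n"
  unfolding alternating_def by (subst card_image) (auto simp: inj_on_def)

text \<open>A vertex outside the set is dominated by its rung partner and by a horizontal neighbour,
  since an adjacent column selects the opposite row.\<close>

lemma two_dominating_set_alternating:
  assumes "2 \<le> n"
  shows "two_dominating_set (grid_graph 2 n) (alternating n)"
  unfolding two_dominating_set_def
proof (intro conjI ballI)
  show "alternating n \<subseteq> verts (grid_graph 2 n)"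
    by (auto simp: alternating_def)
  fix v assume v: "v \<in> verts (grid_graph 2 n) - alternating n"
  obtain r j where [simp]: "v = (r, j)" by force
  have rj: "r \<in> {1..2}" "j \<in> {1..n}" and "(r, j) \<notin> alternating n"
    using v by auto
  then have "r \<noteq> 1 + j mod 2"
    by (auto simp: alternating_def)
  then have r: "r = 2 - j mod 2"
    using rj mod_less_divisor[of 2 j] by (simp del: mod_less_divisor) linarith
  \<comment> \<open>An adjacent column: the left one, or column 2 when \<open>j = 1\<close>, which
    exists because \<open>2 \<le> n\<close>.\<close>
  define k where "k = (if j = 1 then 2 else j - 1)"
  have k: "k \<in> {1..n}" "\<bar>int j - int k\<bar> = 1" "1 + k mod 2 = r"
  proof -
    show "k \<in> {1..n}" "\<bar>int j - int k\<bar> = 1"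
      using rj assms by (auto simp: k_def)
    show "1 + k mod 2 = r"
    proof (cases "j = 1")
      case False
      then have "j = Suc k" using rj by (simp add: k_def)
      then show ?thesis unfolding r by (simp add: mod_Suc)
    qed (simp add: k_def r)
  qed
  let ?N = "neighbours (grid_graph 2 n) v \<inter> alternating n"
  let ?A = "{(1 + j mod 2, j), (r, k)}"
  have "?A \<subseteq> ?N"
  proof -
    have "(1 + j mod 2, j) \<in> alternating n" "(r, k) \<in> alternating n"
      using rj k by (auto simp: alternating_def)
    moreover have "\<bar>int (1 + j mod 2) - int r\<bar> = 1" "1 + j mod 2 \<in> {1..2}"
      unfolding r by (cases "even j"; simp add: even_iff_mod_2_eq_zero odd_iff_mod_2_eq_one)+
    ultimately show ?thesis
      using rj k by (auto simp: neighbours_def edge_grid_graph_iff)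
  qed
  moreover have "finite ?N"
    by (simp add: alternating_def)
  ultimately have "card ?A \<le> card ?N"
    by (intro card_mono)
  moreover have "j \<noteq> k"
    using k(2) by auto
  then have "card ?A = 2"
    by simp
  ultimately show "2 \<le> card ?N"
    by simp
qed

lemma two_domination_number_ladder:
  assumes "2 \<le> n"
  shows "two_domination_number (grid_graph 2 n) = enat n"
  unfolding two_domination_number_def
proof (rule antisym)
  show "Inf {enat (card D) |D. two_dominating_set (grid_graph 2 n) D} \<le> enat n"
    using two_dominating_set_alternating[OF assms] card_alternating[of n]
    by (intro Inf_lower CollectI exI[of _ "alternating n"]) simp
  show "enat n \<le> Inf {enat (card D) |D. two_dominating_set (grid_graph 2 n) D}"
    using card_ladder_two_dominating_set by (intro Inf_greatest) auto
qed

text \<open>Without the rung, \<open>(r, 1)\<close> has at most the neighbour \<open>(r, 2)\<close>,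
  too few for a vertex outside \<open>D\<close>.\<close>

lemma end_column_in_two_dominating_set:
  assumes D: "two_dominating_set (delete_edges (grid_graph 2 n) {{(1, 1), (2, 1)}}) D"
    and "1 \<le> n" and r: "r \<in> {1, 2}"
  shows "(r, 1) \<in> D"
proof (rule ccontr)
  let ?N = "neighbours (delete_edges (grid_graph 2 n) {{(1, 1), (2, 1)}}) (r, 1)"
  assume "(r, 1) \<notin> D"
  then have "2 \<le> card (?N \<inter> D)"
    using assms by (auto simp: two_dominating_set_def)
  moreover have "?N \<subseteq> {(r, 2)}"
    using r by (auto simp: neighbours_def delete_edges_def edge_grid_graph_iff)
  then have "card (?N \<inter> D) \<le> card {(r, 2::nat)}"
    by (intro card_mono) auto
  ultimately show False by simp
qed

lemma two_domination_number_ladder_delete_end_rung: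
  assumes "1 \<le> n"
  shows "enat (Suc n) \<le>
    two_domination_number (delete_edges (grid_graph 2 n) {{(1, 1), (2, 1)}})"
  unfolding two_domination_number_def
proof (rule Inf_greatest, clarify)
  fix D assume D: "two_dominating_set (delete_edges (grid_graph 2 n) {{(1, 1), (2, 1)}}) D"
  have "two_dominating_set (grid_graph 2 n) D"
    by (rule two_dominating_set_delete_edgesD[OF _ D]) simp
  then show "enat (Suc n) \<le> enat (card D)"
    unfolding enat_ord_simps
    by (rule card_ladder_two_dominating_set_full_column)
      (auto intro: end_column_in_two_dominating_set[OF D assms] simp del: One_nat_def)
qed

lemma one_le_two_bondage_number:
  assumes "finite_simple_graph G"
  shows "1 \<le> two_bondage_number G"
  unfolding two_bondage_number_def
proof (rule Inf_greatest, clarify)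
  fix B
  assume "B \<subseteq> edges G"
    and gt: "two_domination_number G < two_domination_number (delete_edges G B)"
  moreover have "edges G \<subseteq> Pow (verts G)" "finite (verts G)"
    using assms by (auto simp: finite_simple_graph_def)
  \<comment> \<open>An infinite set would also have \<open>card\<close> equal to 0, so nonemptiness
    alone does not give the bound.\<close>
  ultimately have "finite B"
    by (meson finite_Pow_iff finite_subset)
  moreover have "B \<noteq> {}"
    using gt by auto
  ultimately show "1 \<le> enat (card B)"
    by (simp add: one_enat_def Suc_le_eq card_gt_0_iff)
qed

theorem theorem1:
  fixes n :: nat
  assumes "n \<ge> 2"
  shows "two_domination_number (grid_graph 2 n) = enat n \<and>
         two_bondage_number (grid_graph 2 n) = 1"
proof
  let ?G = "grid_graph 2 n" and ?B = "{{(1, 1), (2, 1)}} :: (nat \<times> nat) set set"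
  show gamma: "two_domination_number ?G = enat n"
    using assms by (rule two_domination_number_ladder)
  show "two_bondage_number ?G = 1"
  proof (rule antisym)
    have "enat n < enat (Suc n)" by simp
    also have "\<dots> \<le> two_domination_number (delete_edges ?G ?B)"
      using assms by (intro two_domination_number_ladder_delete_end_rung) simp
    finally have "two_domination_number ?G < two_domination_number (delete_edges ?G ?B)"
      by (simp add: gamma)
    moreover have "?B \<subseteq> edges ?G"
      using assms by (simp add: edge_grid_graph_iff)
    moreover have "enat (card ?B) = 1"
      by (simp add: one_enat_def)
    ultimately show "two_bondage_number ?G \<le> 1"
      unfolding two_bondage_number_def by (intro Inf_lower CollectI exI[of _ ?B] conjI) (rule sym)
    show "1 \<le> two_bondage_number ?G"
      by (rule one_le_two_bondage_number[OF finite_simple_graph_grid_graph])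
  qed
qed

end
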